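(* Let $n>2$, let $(G,f)$ be an $n$-ary group, let $a\in G$, and let $G^{\ast}_a$ be the covering group of $(G,f)$. There is a bijection between the set of all irreducible representations of $(G,f)$ and the set of all irreducible representations of $G^{\ast}_a$ whose kernels are not disjoint from $G\subseteq G^{\ast}_a$.
   Context: An $n$-ary group ($n>2$) is a non-empty set $G$ with an operation $f:G^n\to G$ that is associative, i.e. $f(x_1,\ldots,x_{i-1},f(x_i,\ldots,x_{n+i-1}),x_{n+i},\ldots,x_{2n-1})$ does not depend on $i\in\{1,\ldots,n\}$, and such that for every $i$ the equation $f(x_1,\ldots,x_{i-1},z,x_{i+1},\ldots,x_n)=x_0$ has a unique solution $z\in G$ for all given elements. The symbol $\stackrel{(t)}{x}$ denotes $x$ repeated $t$ times (empty if $t=0$). The skew element $\overline{x}$ of $x$ is the unique $z$ with $f(\stackrel{(n-1)}{x},z)=x$. Covering group: for $a\in G$, $G_a^{\ast}=G\times\mathbb{Z}_{n-1}$ (second coordinates taken in $\{0,\ldots,n-2\}$) with multiplication $$\langle x,r\rangle\cdot\langle y,s\rangle = \langle f_{\ast}(x,\stackrel{(r)}{a},y,\stackrel{(s)}{a},\overline{a},\stackrel{(n-2-r\diamond s)}{a}),\,r\diamond s\rangle ,$$ where $r\diamond s=(r+s+1)\ ({\rm mod}\ (n-1))$ and $f_\ast$ means that $f$ is applied once or twice, according to whether the sequence has $n$ or $2n-1$ entries. This is a group with identity $\langle\overline{a},n-2\rangle$. The set $G$ is identified with the subset $\{\langle x,0\rangle:x\in G\}$ of $G_a^\ast$; under this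 identification $f(x_1,\ldots,x_n)=x_1\cdot x_2\cdot\ldots\cdot x_n$. All vector spaces are finite dimensional over $\mathbb{C}$. A representation of the $n$-ary group $(G,f)$ is a map $\Lambda:G\to GL(V)$ with $\Lambda(f(x_1,\ldots,x_n))=\Lambda(x_1)\cdots\Lambda(x_n)$ for all $x_i\in G$ such that $\ker\Lambda=\{x\in G:\Lambda(x)=\mathrm{id}\}$ is non-empty; it is irreducible if $V\neq 0$ and the only subspaces of $V$ invariant under all $\Lambda(x)$, $x\in G$, are $0$ and $V$. Representations of $G_a^\ast$ are ordinary group representations. *)

theory Defs
  imports Complex_Main "HOL-Algebra.Bij" "HOL-Algebra.Coset"
begin

section \<open>Polyadic groups\<close>

text \<open>An \<open>n\<close>-ary operation on \<open>G\<close> is a function on lists, of which only the values on lists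
  of length \<open>n\<close> with entries in \<open>G\<close> matter. Argument positions are counted from \<open>0\<close>.\<close>

locale n_ary_group =
  fixes n :: nat and G :: "'a set" and f :: "'a list \<Rightarrow> 'a"
  assumes arity: "n > 2"
    and nonempty: "G \<noteq> {}"
    and closed: "\<And>xs. xs \<in> lists G \<Longrightarrow> length xs = n \<Longrightarrow> f xs \<in> G"
    and assoc: "\<And>xs i j. xs \<in> lists G \<Longrightarrow> length xs = 2 * n - 1 \<Longrightarrow> i < n \<Longrightarrow> j < n \<Longrightarrow>
        f (take i xs @ [f (take n (drop i xs))] @ drop (i + n) xs) =
        f (take j xs @ [f (take n (drop j xs))] @ drop (j + n) xs)"
    and solvable: "\<And>xs i x0. xs \<in> lists G \<Longrightarrow> length xs = n \<Longrightarrow> i < n \<Longrightarrow> x0 \<in> G \<Longrightarrow>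
        \<exists>!z. z \<in> G \<and> f (xs[i := z]) = x0"

definition skew :: "nat \<Rightarrow> 'a set \<Rightarrow> ('a list \<Rightarrow> 'a) \<Rightarrow> 'a \<Rightarrow> 'a" where
  "skew n G f x = (THE z. z \<in> G \<and> f (replicate (n - 1) x @ [z]) = x)"

text \<open>One or two applications of \<open>f\<close>, for sequences with \<open>n\<close> or \<open>2n - 1\<close> entries; by
  associativity the position of the inner application is immaterial.\<close>

definition f_star :: "nat \<Rightarrow> ('a list \<Rightarrow> 'a) \<Rightarrow> 'a list \<Rightarrow> 'a" where
  "f_star n f xs = (if length xs = n then f xs else f (f (take n xs) # drop n xs))"

definition diamond :: "nat \<Rightarrow> nat \<Rightarrow> nat \<Rightarrow> nat" where
  "diamond n r s = (r + s + 1) mod (n - 1)"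

definition covering_group ::
    "nat \<Rightarrow> 'a set \<Rightarrow> ('a list \<Rightarrow> 'a) \<Rightarrow> 'a \<Rightarrow> ('a \<times> nat) monoid" where
  "covering_group n G f a =
    \<lparr>carrier = G \<times> {0..n - 2},
     mult = (\<lambda>(x, r) (y, s).
       (f_star n f ([x] @ replicate r a @ [y] @ replicate s a @ [skew n G f a]
          @ replicate (n - 2 - diamond n r s) a),
        diamond n r s)),
     one = (skew n G f a, n - 2)\<rparr>"

section \<open>Finite dimensional complex representations\<close>

text \<open>A finite dimensional vector space is a finite dimensional subspace \<open>V\<close> of an ambient
  complex vector space, which consists of all elements of the type \<open>'v\<close> with scalar
  multiplication \<open>scale\<close>. The ambient space is an arbitrary parameter and may have any dimension.\<close>

definition fin_dim_subspace :: "(complex \<Rightarrow> 'v \<Rightarrow> 'v) \<Rightarrow> 'v::ab_group_add set \<Rightarrow> bool" where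
  "fin_dim_subspace scale V \<longleftrightarrow>
    module.subspace scale V \<and> (\<exists>B. finite B \<and> module.span scale B = V)"

definition GL :: "(complex \<Rightarrow> 'v \<Rightarrow> 'v) \<Rightarrow> 'v::ab_group_add set \<Rightarrow> ('v \<Rightarrow> 'v) monoid" where
  "GL scale V = (BijGroup V)\<lparr>carrier := {T \<in> Bij V.
     (\<forall>u\<in>V. \<forall>v\<in>V. T (u + v) = T u + T v) \<and> (\<forall>c. \<forall>v\<in>V. T (scale c v) = scale c (T v))}\<rparr>"

definition irreducible_on ::
    "(complex \<Rightarrow> 'v \<Rightarrow> 'v) \<Rightarrow> 'v::ab_group_add set \<Rightarrow> ('v \<Rightarrow> 'v) set \<Rightarrow> bool" where
  "irreducible_on scale V S \<longleftrightarrow> V \<noteq> {0} \<and>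
    (\<forall>W. module.subspace scale W \<and> W \<subseteq> V \<and> (\<forall>T\<in>S. T ` W \<subseteq> W) \<longrightarrow> W = {0} \<or> W = V)"

text \<open>Representations are extensional functions (undefined outside their domain), so that equality
  of HOL functions is equality of maps on the domain.\<close>

definition n_ary_rep :: "nat \<Rightarrow> 'a set \<Rightarrow> ('a list \<Rightarrow> 'a) \<Rightarrow>
    (complex \<Rightarrow> 'v \<Rightarrow> 'v) \<Rightarrow> 'v::ab_group_add set \<Rightarrow> ('a \<Rightarrow> 'v \<Rightarrow> 'v) \<Rightarrow> bool" where
  "n_ary_rep n G f scale V \<Lambda> \<longleftrightarrow>
    \<Lambda> \<in> G \<rightarrow>\<^sub>E carrier (GL scale V) \<and>
    (\<forall>xs \<in> lists G. length xs = n \<longrightarrow>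
       \<Lambda> (f xs) = foldr (\<otimes>\<^bsub>GL scale V\<^esub>) (map \<Lambda> xs) \<one>\<^bsub>GL scale V\<^esub>) \<and>
    {x \<in> G. \<Lambda> x = \<one>\<^bsub>GL scale V\<^esub>} \<noteq> {}"

definition group_rep :: "('g, 'b) monoid_scheme \<Rightarrow>
    (complex \<Rightarrow> 'v \<Rightarrow> 'v) \<Rightarrow> 'v::ab_group_add set \<Rightarrow> ('g \<Rightarrow> 'v \<Rightarrow> 'v) \<Rightarrow> bool" where
  "group_rep H scale V \<Lambda> \<longleftrightarrow> \<Lambda> \<in> hom H (GL scale V) \<inter> extensional (carrier H)"

definition n_ary_irreps :: "nat \<Rightarrow> 'a set \<Rightarrow> ('a list \<Rightarrow> 'a) \<Rightarrow>
    (complex \<Rightarrow> 'v \<Rightarrow> 'v) \<Rightarrow> ('v::ab_group_add set \<times> ('a \<Rightarrow> 'v \<Rightarrow> 'v)) set" where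
  "n_ary_irreps n G f scale = {(V, \<Lambda>).
     fin_dim_subspace scale V \<and> n_ary_rep n G f scale V \<Lambda> \<and> irreducible_on scale V (\<Lambda> ` G)}"

definition group_irreps :: "('g, 'b) monoid_scheme \<Rightarrow>
    (complex \<Rightarrow> 'v \<Rightarrow> 'v) \<Rightarrow> ('v::ab_group_add set \<times> ('g \<Rightarrow> 'v \<Rightarrow> 'v)) set" where
  "group_irreps H scale = {(V, \<Lambda>).
     fin_dim_subspace scale V \<and> group_rep H scale V \<Lambda> \<and> irreducible_on scale V (\<Lambda> ` carrier H)}"

end

theory Submission
  imports Defs
begin

text \<open>
  In the covering group the pair \<open>(x, r)\<close> is the product of \<open>(x, 0)\<close> with \<open>r\<close> copies of \<open>(a, 0)\<close>.
  Hence a homomorphism \<open>\<Gamma>\<close> on the covering group is determined by its restriction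
  \<open>\<Lambda> x = \<Gamma> (x, 0)\<close> to \<open>G\<close>, through \<open>\<Gamma> (x, r) = \<Lambda> x \<cdot> (\<Lambda> a)\<^sup>r\<close>, and the bijection sends \<open>\<Lambda>\<close> to
  the \<open>\<Gamma>\<close> given by this formula.

  That restriction turns homomorphisms into \<open>n\<close>-ary homomorphisms is a statement about the covering
  group: the product of the \<open>(x\<^sub>i, 0)\<close> is \<open>(f [x\<^sub>1, \<dots>, x\<^sub>n], 0)\<close>. Its partial products are computed
  in \<open>hom_covering_partial_product\<close>; what makes the computation work is Doernte's identity
  \<open>skew_right_neutral\<close>, by which a skew element cancels \<open>n - 2\<close> copies of \<open>a\<close>, wherever it stands
  among them. Conversely, for an \<open>n\<close>-ary homomorphism \<open>\<Lambda>\<close> into a group, applying \<open>\<Lambda>\<close> to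
  \<open>f [a, \<dots>, a, skew a] = a\<close> shows that \<open>\<Lambda> (skew a)\<close> is the inverse of \<open>(\<Lambda> a)\<^sup>n\<^sup>-\<^sup>2\<close>, and this is
  exactly the correction inserted by the covering multiplication (\<open>extend_hom\<close>).

  The two constructions respect the remaining conditions. Every operator \<open>\<Gamma> (x, r)\<close> is a product of
  operators \<open>\<Lambda> y\<close>, so both families have the same invariant subspaces. The kernel of \<open>\<Lambda>\<close> is the
  part of the kernel of \<open>\<Gamma>\<close> that lies in \<open>G\<close>.
\<close>

section \<open>Doernte's identity for the skew element\<close>

context n_ary_group
begin

text \<open>The associative law in the form that does not mention positions: two ways to bracket the same
  sequence agree.\<close>

lemma rebracket:
  assumes eq: "us @ vs @ ws = us' @ vs' @ ws'"
    and len: "length vs = n" "length vs' = n" "length us + length ws = n - 1"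
    and mem: "set us \<subseteq> G" "set vs \<subseteq> G" "set ws \<subseteq> G"
  shows "f (us @ f vs # ws) = f (us' @ f vs' # ws')"
proof -
  let ?xs = "us @ vs @ ws"
  have total: "length ?xs = length us' + length vs' + length ws'"
    by (subst eq) simp
  have "length ?xs = 2 * n - 1" "length us < n" "length us' < n"
    using len total arity by auto
  moreover have "?xs \<in> lists G"
    using mem by auto
  ultimately have *: "f (take (length us) ?xs @ [f (take n (drop (length us) ?xs))] @ drop (length us + n) ?xs) =
      f (take (length us') ?xs @ [f (take n (drop (length us') ?xs))] @ drop (length us' + n) ?xs)"
    by (intro assoc)
  have left: "take (length us) ?xs @ [f (take n (drop (length us) ?xs))] @ drop (length us + n) ?xs
      = us @ f vs # ws"
    using len(1) by simp
  have "take (length us') ?xs @ [f (take n (drop (length us') ?xs))] @ drop (length us' + n) ?xs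
      = us' @ f vs' # ws'"
    unfolding eq using len(2) by simp
  with * left show ?thesis
    by simp
qed

lemma cancel_position:
  assumes "f (us @ z # ws) = f (us @ z' # ws)" "length us + length ws = n - 1"
    and "set us \<subseteq> G" "set ws \<subseteq> G" "z \<in> G" "z' \<in> G"
  shows "z = z'"
proof -
  let ?xs = "us @ z # ws"
  have "\<exists>!y. y \<in> G \<and> f (?xs[length us := y]) = f ?xs"
    using assms arity by (intro solvable closed) auto
  moreover have "f (?xs[length us := z]) = f ?xs" "f (?xs[length us := z']) = f ?xs"
    using assms(1) by simp_all
  ultimately show ?thesis
    using assms(5,6) by blast
qed

lemma skew_prop:
  assumes "a \<in> G"
  shows skew_closed: "skew n G f a \<in> G"
    and f_skew: "f (replicate (n - 1) a @ [skew n G f a]) = a"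
proof -
  have "\<exists>!z. z \<in> G \<and> f ((replicate (n - 1) a @ [a])[n - 1 := z]) = a"
    using assms arity by (intro solvable) auto
  then have "\<exists>!z. z \<in> G \<and> f (replicate (n - 1) a @ [z]) = a"
    by (simp add: list_update_append)
  from theI'[OF this] show "skew n G f a \<in> G" "f (replicate (n - 1) a @ [skew n G f a]) = a"
    by (auto simp: skew_def)
qed

text \<open>The position of the skew element can be moved: completing the left-hand side to a sequence of
  \<open>2n - 1\<close> entries with the skew element in the middle and bracketing it from the left, one obtains
  the value of \<open>f\<close> on \<open>n\<close> copies of \<open>a\<close>, and cancels.\<close>

lemma f_skew_shifted:
  assumes a: "a \<in> G" and i: "i \<le> n - 2"
  shows "f (replicate (Suc i) a @ skew n G f a # replicate (n - 2 - i) a) = a"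
proof -
  let ?s = "skew n G f a"
  let ?u = "f (replicate (Suc i) a @ ?s # replicate (n - 2 - i) a)"
  note s = skew_closed[OF a]
  have "f (replicate (n - 2 - i) a @ ?u # replicate (Suc i) a)
      = f ([] @ f (replicate (n - 1) a @ [?s]) # replicate (n - 1) a)"
  proof (rule rebracket)
    have "replicate (n - 2 - i) a @ (replicate (Suc i) a @ ?s # replicate (n - 2 - i) a)
        @ replicate (Suc i) a = (replicate (n - 2 - i) a @ replicate (Suc i) a) @ [?s] @
        (replicate (n - 2 - i) a @ replicate (Suc i) a)"
      by (simp only: append.assoc append_Cons append_Nil)
    also have "replicate (n - 2 - i) a @ replicate (Suc i) a = replicate (n - 1) a"
      using i arity by (subst replicate_add[symmetric]) (rule arg_cong2[of _ _ _ _ replicate], auto)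
    finally show "replicate (n - 2 - i) a @ (replicate (Suc i) a @ ?s # replicate (n - 2 - i) a)
        @ replicate (Suc i) a = [] @ (replicate (n - 1) a @ [?s]) @ replicate (n - 1) a"
      by (simp only: append.assoc append_Cons append_Nil)
  qed (use a s i arity in auto)
  also have "\<dots> = f (replicate (n - 2 - i) a @ a # replicate (Suc i) a)"
  proof -
    have "replicate (n - 2 - i) a @ a # replicate (Suc i) a
        = replicate (n - 2 - i) a @ replicate (Suc (Suc i)) a"
      by (simp only: replicate_Suc)
    also have "\<dots> = replicate (Suc (n - 1)) a"
      using i arity by (subst replicate_add[symmetric]) (rule arg_cong2[of _ _ _ _ replicate], auto)
    finally have "a # replicate (n - 1) a = replicate (n - 2 - i) a @ a # replicate (Suc i) a"
      by (simp only: replicate_Suc)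
    then show ?thesis
      by (simp only: f_skew[OF a] append_Nil)
  qed
  finally show ?thesis
    by (rule cancel_position) (use a s i arity in \<open>auto intro!: closed\<close>)
qed

text \<open>One half of Doernte's identity. Write \<open>x\<close> as \<open>f [z, a, \<dots>, a]\<close> and move the inner bracket
  to the right end, where \<open>f_skew_shifted\<close> removes the skew element.\<close>

lemma skew_right_neutral:
  assumes a: "a \<in> G" and x: "x \<in> G" and i: "i \<le> n - 2"
  shows "f (x # replicate i a @ skew n G f a # replicate (n - 2 - i) a) = x"
proof -
  let ?s = "skew n G f a"
  note s = skew_closed[OF a]
  have "\<exists>!z. z \<in> G \<and> f ((a # replicate (n - 1) a)[0 := z]) = x"
    using a x arity by (intro solvable) auto
  then obtain z where z: "z \<in> G" "f (z # replicate (n - 1) a) = x"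
    by auto
  have "f ([] @ f (z # replicate (n - 1) a) # (replicate i a @ ?s # replicate (n - 2 - i) a))
      = f ((z # replicate (n - 2) a) @ f (replicate (Suc i) a @ ?s # replicate (n - 2 - i) a) # [])"
  proof (rule rebracket)
    have "replicate (n - 1) a @ replicate i a = replicate (n - 2) a @ replicate (Suc i) a"
      unfolding replicate_add[symmetric] using arity
      by (intro arg_cong2[of _ _ _ _ replicate]) auto
    then have "(replicate (n - 1) a @ replicate i a) @ ?s # replicate (n - 2 - i) a
        = (replicate (n - 2) a @ replicate (Suc i) a) @ ?s # replicate (n - 2 - i) a"
      by (rule arg_cong)
    then show "[] @ (z # replicate (n - 1) a) @ replicate i a @ ?s # replicate (n - 2 - i) a =
      (z # replicate (n - 2) a) @ (replicate (Suc i) a @ ?s # replicate (n - 2 - i) a) @ []"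
      by (simp only: append.assoc append_Cons append_Nil append_Nil2)
  qed (use a s z i arity in auto)
  also have "\<dots> = f (z # replicate (n - 2) a @ [a])"
    unfolding f_skew_shifted[OF a i] by simp
  also have "replicate (n - 2) a @ [a] = replicate (n - 1) a"
  proof -
    have "Suc (n - 2) = n - 1"
      using arity by simp
    then show ?thesis
      by (metis replicate_append_same replicate_Suc)
  qed
  finally show ?thesis
    using z by simp
qed

end

section \<open>Homomorphisms on the covering group\<close>

text \<open>The values of the representations of \<open>(G, f)\<close> lie in a group; the correspondence is
  established for an arbitrary group \<open>H\<close> in this role.\<close>

locale covering = n_ary_group n G f + H: group H
  for n :: nat and G :: "'a set" and f :: "'a list \<Rightarrow> 'a" and H :: "('h, 'm) monoid_scheme" +
  fixes a :: 'a
  assumes base: "a \<in> G"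
begin

abbreviation "C \<equiv> covering_group n G f a"
abbreviation "s \<equiv> skew n G f a"

abbreviation list_prod :: "'h list \<Rightarrow> 'h" where
  "list_prod hs \<equiv> foldr (\<otimes>\<^bsub>H\<^esub>) hs \<one>\<^bsub>H\<^esub>"

definition n_ary_hom :: "('a \<Rightarrow> 'h) \<Rightarrow> bool" where
  "n_ary_hom \<Lambda> \<longleftrightarrow> \<Lambda> \<in> G \<rightarrow> carrier H \<and>
    (\<forall>xs \<in> lists G. length xs = n \<longrightarrow> \<Lambda> (f xs) = list_prod (map \<Lambda> xs))"

definition extend :: "('a \<Rightarrow> 'h) \<Rightarrow> 'a \<times> nat \<Rightarrow> 'h" where
  "extend \<Lambda> = (\<lambda>(x, r) \<in> G \<times> {0..n - 2}. \<Lambda> x \<otimes>\<^bsub>H\<^esub> \<Lambda> a [^]\<^bsub>H\<^esub> r)"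

lemma carrier_C: "carrier C = G \<times> {0..n - 2}"
  by (simp add: covering_group_def)

lemma mult_C: "(x, r) \<otimes>\<^bsub>C\<^esub> (y, t) =
    (f_star n f (x # replicate r a @ y # replicate t a @ s # replicate (n - 2 - diamond n r t) a),
     diamond n r t)"
  by (simp add: covering_group_def)

lemmas s_closed = skew_closed[OF base]

subsection \<open>Restriction to \<open>G\<close>\<close>

text \<open>In the range of indices where the addition of second coordinates does not wrap around, one
  application of \<open>f\<close> suffices.\<close>

lemma mult_C_no_wrap:
  assumes "Suc (r + t) \<le> n - 2"
  shows "(x, r) \<otimes>\<^bsub>C\<^esub> (y, t) =
    (f (x # replicate r a @ y # replicate t a @ s # replicate (n - 3 - r - t) a), Suc (r + t))"
proof -
  have "diamond n r t = Suc (r + t)"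
    using assms arity by (simp add: diamond_def)
  moreover have "n - 2 - Suc (r + t) = n - 3 - r - t"
    by simp
  moreover have "length (x # replicate r a @ y # replicate t a @ s # replicate (n - 3 - r - t) a) = n"
    using assms arity by simp
  ultimately show ?thesis
    by (simp only: mult_C f_star_def if_True simp_thms)
qed

text \<open>Multiplication by \<open>(a, 0)\<close> only raises the second coordinate, which therefore counts factors
  \<open>(a, 0)\<close>.\<close>

lemma mult_base:
  assumes "x \<in> G" "Suc r \<le> n - 2"
  shows "(x, r) \<otimes>\<^bsub>C\<^esub> (a, 0) = (x, Suc r)"
proof -
  have "f (x # replicate (Suc r) a @ s # replicate (n - 2 - Suc r) a) = x"
    by (rule skew_right_neutral) (use assms base in auto)
  then show ?thesis
    using assms mult_C_no_wrap[of r 0 x a]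
    by (simp add: replicate_app_Cons_same numeral_3_eq_3 numeral_2_eq_2)
qed

text \<open>This completes a product of \<open>n\<close> elements of \<open>G\<close>, once \<open>n - 1\<close> of them are multiplied: the second coordinate
  returns to \<open>0\<close>, and the outer of the two applications of \<open>f\<close> is undone by the skew element.\<close>

lemma mult_wrap:
  assumes "x \<in> G" "y \<in> G"
  shows "(x, 0) \<otimes>\<^bsub>C\<^esub> (y, n - 2) = (f (x # y # replicate (n - 2) a), 0)"
proof -
  have "diamond n 0 (n - 2) = 0"
    using arity by (simp add: diamond_def Suc_diff_Suc numeral_2_eq_2)
  moreover have "f (f (x # y # replicate (n - 2) a) # replicate 0 a @ s # replicate (n - 2 - 0) a)
      = f (x # y # replicate (n - 2) a)"
    by (rule skew_right_neutral) (use assms base arity in \<open>auto intro!: closed\<close>)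
  moreover have "f_star n f (x # y # replicate (n - 2) a @ s # replicate (n - 2) a)
      = f (f (x # y # replicate (n - 2) a) # s # replicate (n - 2) a)"
  proof -
    have "length (x # y # replicate (n - 2) a) = n"
      using arity by simp
    then have "take n ((x # y # replicate (n - 2) a) @ s # replicate (n - 2) a)
        = x # y # replicate (n - 2) a"
      and "drop n ((x # y # replicate (n - 2) a) @ s # replicate (n - 2) a) = s # replicate (n - 2) a"
      by (simp_all del: append_Cons length_Cons)
    moreover have "length (x # y # replicate (n - 2) a @ s # replicate (n - 2) a) \<noteq> n"
      using arity by simp
    ultimately show ?thesis
      by (simp only: f_star_def if_False append_Cons)
  qed
  ultimately show ?thesis
    by (simp add: mult_C)
qed

text \<open>The product of \<open>m < n\<close> elements of \<open>G\<close>, formed in the covering group. The sequence is padded to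
  length \<open>n\<close> by a skew element and \<open>n - 1 - m\<close> copies of \<open>a\<close>; together with the \<open>m - 1\<close> copies of
  \<open>a\<close> recorded in the second coordinate these are \<open>n - 2\<close> copies, which the skew element cancels.\<close>

lemma hom_covering_partial_product:
  assumes \<Gamma>: "\<Gamma> \<in> hom C H"
    and "xs \<noteq> []" "set xs \<subseteq> G" "length xs \<le> n - 1"
  shows "\<Gamma> (f (xs @ s # replicate (n - 1 - length xs) a), length xs - 1)
    = list_prod (map (\<lambda>x. \<Gamma> (x, 0)) xs)"
  using assms(2-4)
proof (induction xs rule: list_nonempty_induct)
  case (single x)
  have "f (x # replicate 0 a @ s # replicate (n - 2 - 0) a) = x"
    by (rule skew_right_neutral) (use single base in auto)
  moreover have "\<Gamma> (x, 0) \<in> carrier H"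
    using single \<Gamma> by (auto simp: hom_def carrier_C)
  ultimately show ?case
    by (simp add: numeral_2_eq_2)
next
  case (cons x xs)
  define m where "m = length xs - 1"
  have m: "length xs = Suc m" "Suc m \<le> n - 2"
    using cons.hyps cons.prems arity by (auto simp: m_def Suc_le_eq)
  let ?y = "f (xs @ s # replicate (n - 1 - length xs) a)"
  have y: "?y \<in> G"
    using cons.prems base s_closed m arity by (intro closed) auto
  have "f ([x] @ ?y # (replicate m a @ s # replicate (n - 3 - m) a))
      = f ([] @ f (x # xs @ s # replicate (n - 3 - m) a) # (a # replicate m a @ s # replicate (n - 3 - m) a))"
  proof (rule rebracket)
    have "replicate (n - 1 - length xs) a = replicate (n - 3 - m) a @ [a]"
      using m by (simp add: replicate_append_same flip: replicate_Suc)
    then show "[x] @ (xs @ s # replicate (n - 1 - length xs) a) @ replicate m a @ s # replicate (n - 3 - m) a =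
      [] @ (x # xs @ s # replicate (n - 3 - m) a) @ a # replicate m a @ s # replicate (n - 3 - m) a"
      by simp
  qed (use cons.prems base s_closed m in auto)
  also have "\<dots> = f (x # xs @ s # replicate (n - 3 - m) a)"
  proof -
    have "f (f (x # xs @ s # replicate (n - 3 - m) a) # replicate (Suc m) a @ s # replicate (n - 2 - Suc m) a)
        = f (x # xs @ s # replicate (n - 3 - m) a)"
      by (rule skew_right_neutral) (use cons.prems base s_closed m in \<open>auto intro!: closed\<close>)
    moreover have "n - 2 - Suc m = n - 3 - m"
      by simp
    ultimately show ?thesis
      by simp
  qed
  finally have "(x, 0) \<otimes>\<^bsub>C\<^esub> (?y, m) = (f (x # xs @ s # replicate (n - 3 - m) a), Suc m)"
    using m by (simp add: mult_C_no_wrap)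
  moreover have "\<Gamma> ((x, 0) \<otimes>\<^bsub>C\<^esub> (?y, m)) = \<Gamma> (x, 0) \<otimes>\<^bsub>H\<^esub> \<Gamma> (?y, m)"
    using cons.prems y m \<Gamma> by (intro hom_mult[OF \<Gamma>]) (auto simp: carrier_C)
  moreover have "\<Gamma> (?y, m) = list_prod (map (\<lambda>x. \<Gamma> (x, 0)) xs)"
    using cons.IH cons.prems m by simp
  moreover have "n - 1 - length (x # xs) = n - 3 - m"
    using m by simp
  ultimately show ?case
    using m by simp
qed

text \<open>For \<open>n - 1\<close> factors the padding is just the skew element and the second coordinate is \<open>n - 2\<close>,
  so multiplying by one more factor is the case of \<open>mult_wrap\<close>.\<close>

lemma n_ary_hom_restrict:
  assumes \<Gamma>: "\<Gamma> \<in> hom C H"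
  shows "n_ary_hom (\<lambda>x. \<Gamma> (x, 0))"
  unfolding n_ary_hom_def
proof (intro conjI ballI impI)
  show "(\<lambda>x. \<Gamma> (x, 0)) \<in> G \<rightarrow> carrier H"
    using \<Gamma> by (auto simp: hom_def carrier_C)
next
  fix xs assume "xs \<in> lists G" and len: "length xs = n"
  then obtain x ys where xs: "xs = x # ys" "x \<in> G" "set ys \<subseteq> G"
    using arity by (cases xs) auto
  have l: "length ys = n - 1" "ys \<noteq> []"
    using len xs arity by auto
  let ?y = "f (ys @ [s])"
  have y: "?y \<in> G"
    using xs s_closed l arity by (intro closed) auto
  have "f ([x] @ ?y # replicate (n - 2) a) = f ([] @ f (x # ys) # (s # replicate (n - 2) a))"
    using xs s_closed base l arity by (intro rebracket) auto
  also have "\<dots> = f (x # ys)"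
  proof -
    have "f (x # ys) \<in> G"
      using xs l arity by (intro closed) auto
    from skew_right_neutral[OF base this, of 0] show ?thesis
      by simp
  qed
  finally have "(x, 0) \<otimes>\<^bsub>C\<^esub> (?y, n - 2) = (f xs, 0)"
    using mult_wrap[of x ?y] xs y by simp
  then have "\<Gamma> (f xs, 0) = \<Gamma> (x, 0) \<otimes>\<^bsub>H\<^esub> \<Gamma> (?y, n - 2)"
    using hom_mult[OF \<Gamma>, of "(x, 0)" "(?y, n - 2)"] xs y by (simp add: carrier_C)
  moreover have "\<Gamma> (?y, n - 2) = list_prod (map (\<lambda>x. \<Gamma> (x, 0)) ys)"
    using hom_covering_partial_product[OF \<Gamma>, of ys] xs l by (simp add: numeral_2_eq_2)
  ultimately show "\<Gamma> (f xs, 0) = list_prod (map (\<lambda>x. \<Gamma> (x, 0)) xs)"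
    by (simp add: xs)
qed

lemma hom_covering_decompose:
  assumes \<Gamma>: "\<Gamma> \<in> hom C H" and x: "x \<in> G" and "r \<le> n - 2"
  shows "\<Gamma> (x, r) = \<Gamma> (x, 0) \<otimes>\<^bsub>H\<^esub> \<Gamma> (a, 0) [^]\<^bsub>H\<^esub> r"
  using assms(3)
proof (induction r)
  case 0
  have "\<Gamma> (x, 0) \<in> carrier H"
    using \<Gamma> x by (auto simp: hom_def carrier_C)
  then show ?case
    by simp
next
  case (Suc r)
  have "\<Gamma> (x, 0) \<in> carrier H" "\<Gamma> (a, 0) \<in> carrier H"
    using \<Gamma> x base by (auto simp: hom_def carrier_C)
  moreover have "\<Gamma> (x, Suc r) = \<Gamma> (x, r) \<otimes>\<^bsub>H\<^esub> \<Gamma> (a, 0)"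
    using hom_mult[OF \<Gamma>, of "(x, r)" "(a, 0)"] mult_base[OF x Suc.prems] x base Suc.prems
    by (simp add: carrier_C)
  ultimately show ?case
    using Suc by (simp add: H.m_assoc)
qed

subsection \<open>Extension to the covering group\<close>

context
  fixes \<Lambda> assumes \<Lambda>: "n_ary_hom \<Lambda>"
begin

lemma n_ary_hom_closed: "x \<in> G \<Longrightarrow> \<Lambda> x \<in> carrier H"
  using \<Lambda> by (auto simp: n_ary_hom_def)

lemma list_prod_closed: "set xs \<subseteq> G \<Longrightarrow> list_prod (map \<Lambda> xs) \<in> carrier H"
  by (induction xs) (auto simp: n_ary_hom_closed)

lemma list_prod_append:
  "set xs \<subseteq> G \<Longrightarrow> set ys \<subseteq> G \<Longrightarrow>
    list_prod (map \<Lambda> (xs @ ys)) = list_prod (map \<Lambda> xs) \<otimes>\<^bsub>H\<^esub> list_prod (map \<Lambda> ys)"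
  by (induction xs) (use list_prod_closed in \<open>auto simp: n_ary_hom_closed H.m_assoc\<close>)

lemma list_prod_replicate:
  "x \<in> G \<Longrightarrow> list_prod (map \<Lambda> (replicate k x)) = \<Lambda> x [^]\<^bsub>H\<^esub> k"
  by (induction k) (auto simp: n_ary_hom_closed H.nat_pow_Suc2 simp del: nat_pow_Suc H.nat_pow_Suc)

lemma n_ary_hom_f: "set xs \<subseteq> G \<Longrightarrow> length xs = n \<Longrightarrow> \<Lambda> (f xs) = list_prod (map \<Lambda> xs)"
  using \<Lambda> by (auto simp: n_ary_hom_def)

lemma n_ary_hom_f_star:
  assumes "set xs \<subseteq> G" "length xs = n \<or> length xs = 2 * n - 1"
  shows "f_star n f xs \<in> G" "\<Lambda> (f_star n f xs) = list_prod (map \<Lambda> xs)"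
proof -
  have "f_star n f xs \<in> G \<and> \<Lambda> (f_star n f xs) = list_prod (map \<Lambda> xs)"
  proof (cases "length xs = n")
    case True
    then show ?thesis
      using assms closed by (auto simp: f_star_def n_ary_hom_f)
  next
    case False
    have sub: "set (take n xs) \<subseteq> G" "set (drop n xs) \<subseteq> G"
      using assms set_take_subset[of n xs] set_drop_subset[of n xs] by auto
    have len: "length (take n xs) = n" "length (drop n xs) = n - 1"
      using False assms by auto
    have inner: "f (take n xs) \<in> G"
      using sub len by (intro closed) auto
    have "f_star n f xs = f (f (take n xs) # drop n xs)"
      using False by (simp add: f_star_def)
    moreover have "f (f (take n xs) # drop n xs) \<in> G"
      using sub len inner arity by (intro closed) auto
    moreover have "\<Lambda> (f (f (take n xs) # drop n xs)) = list_prod (map \<Lambda> (take n xs @ drop n xs))"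
      using sub len inner arity by (subst list_prod_append) (auto simp: n_ary_hom_f)
    ultimately show ?thesis
      by (metis append_take_drop_id)
  qed
  then show "f_star n f xs \<in> G" "\<Lambda> (f_star n f xs) = list_prod (map \<Lambda> xs)"
    by auto
qed

lemma n_ary_hom_skew: "\<Lambda> s \<otimes>\<^bsub>H\<^esub> \<Lambda> a [^]\<^bsub>H\<^esub> (n - 2) = \<one>\<^bsub>H\<^esub>"
proof -
  let ?A = "\<Lambda> a" and ?S = "\<Lambda> s"
  have cl: "?A \<in> carrier H" "?S \<in> carrier H"
    using base s_closed by (auto intro: n_ary_hom_closed)
  have "?A = list_prod (map \<Lambda> (replicate (n - 1) a @ [s]))"
    using n_ary_hom_f[of "replicate (n - 1) a @ [s]"] f_skew[OF base] base s_closed arity by auto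
  also have "\<dots> = ?A [^]\<^bsub>H\<^esub> (n - 1) \<otimes>\<^bsub>H\<^esub> ?S"
    using base s_closed cl by (subst list_prod_append) (auto simp: list_prod_replicate simp del: map_replicate)
  also have "n - 1 = Suc (n - 2)"
    using arity by simp
  also have "?A [^]\<^bsub>H\<^esub> Suc (n - 2) = ?A \<otimes>\<^bsub>H\<^esub> ?A [^]\<^bsub>H\<^esub> (n - 2)"
    using cl by (intro H.nat_pow_Suc2)
  finally have "?A \<otimes>\<^bsub>H\<^esub> (?A [^]\<^bsub>H\<^esub> (n - 2) \<otimes>\<^bsub>H\<^esub> ?S) = ?A \<otimes>\<^bsub>H\<^esub> \<one>\<^bsub>H\<^esub>"
    using cl by (simp add: H.m_assoc)
  then have "?A [^]\<^bsub>H\<^esub> (n - 2) \<otimes>\<^bsub>H\<^esub> ?S = \<one>\<^bsub>H\<^esub>"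
    using cl by (simp add: H.Units_eq)
  then show ?thesis
    using cl by (auto intro: H.inv_comm)
qed

text \<open>The skew element together with the copies of \<open>a\<close> after it and those recorded in the new second
  coordinate contributes \<open>\<Lambda> s \<cdot> (\<Lambda> a)\<^sup>n\<^sup>-\<^sup>2\<close>, which is the identity.\<close>

lemma extend_hom: "extend \<Lambda> \<in> hom C H"
proof (rule homI)
  fix p assume "p \<in> carrier C"
  then show "extend \<Lambda> p \<in> carrier H"
    using base by (auto simp: carrier_C extend_def n_ary_hom_closed)
next
  fix p q assume "p \<in> carrier C" "q \<in> carrier C"
  then obtain x r y t where pq: "p = (x, r)" "q = (y, t)" and xy: "x \<in> G" "y \<in> G"
    and rt: "r \<le> n - 2" "t \<le> n - 2"
    by (auto simp: carrier_C)
  define d where "d = diamond n r t"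
  have "d < n - 1"
    using arity by (simp add: d_def diamond_def)
  then have d: "d \<le> n - 2"
    by simp
  have wrap: "d = r + t + 1 \<or> d + (n - 1) = r + t + 1"
    using arity rt by (auto simp: d_def diamond_def mod_if)
  let ?zs = "[x] @ replicate r a @ [y] @ replicate t a @ [s] @ replicate (n - 2 - d) a"
  let ?A = "\<Lambda> a"
  have cl: "\<Lambda> x \<in> carrier H" "\<Lambda> y \<in> carrier H" "?A \<in> carrier H" "\<Lambda> s \<in> carrier H"
    using xy base s_closed by (auto intro: n_ary_hom_closed)
  have sub: "set ?zs \<subseteq> G"
    using xy base s_closed by auto
  have len: "length ?zs = n \<or> length ?zs = 2 * n - 1"
    using wrap d arity by auto
  have *: "\<Lambda> (f_star n f ?zs) = \<Lambda> x \<otimes>\<^bsub>H\<^esub> (?A [^]\<^bsub>H\<^esub> r \<otimes>\<^bsub>H\<^esub> (\<Lambda> y \<otimes>\<^bsub>H\<^esub> (?A [^]\<^bsub>H\<^esub> t \<otimes>\<^bsub>H\<^esub>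
      (\<Lambda> s \<otimes>\<^bsub>H\<^esub> ?A [^]\<^bsub>H\<^esub> (n - 2 - d)))))"
    unfolding n_ary_hom_f_star(2)[OF sub len] using xy base s_closed cl
    by (subst list_prod_append, force, force)+ (simp add: list_prod_replicate del: map_replicate)
  have "\<Lambda> s \<otimes>\<^bsub>H\<^esub> ?A [^]\<^bsub>H\<^esub> (n - 2 - d) \<otimes>\<^bsub>H\<^esub> ?A [^]\<^bsub>H\<^esub> d = \<one>\<^bsub>H\<^esub>"
    using cl n_ary_hom_skew le_add_diff_inverse2[OF d] by (simp only: H.m_assoc H.nat_pow_mult H.nat_pow_closed)
  then have "\<Lambda> (f_star n f ?zs) \<otimes>\<^bsub>H\<^esub> ?A [^]\<^bsub>H\<^esub> d
      = (\<Lambda> x \<otimes>\<^bsub>H\<^esub> ?A [^]\<^bsub>H\<^esub> r) \<otimes>\<^bsub>H\<^esub> (\<Lambda> y \<otimes>\<^bsub>H\<^esub> ?A [^]\<^bsub>H\<^esub> t)"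
    unfolding * using cl by (simp add: H.m_assoc)
  moreover have "p \<otimes>\<^bsub>C\<^esub> q = (f_star n f ?zs, d)"
    by (simp add: pq mult_C d_def)
  ultimately show "extend \<Lambda> (p \<otimes>\<^bsub>C\<^esub> q) = extend \<Lambda> p \<otimes>\<^bsub>H\<^esub> extend \<Lambda> q"
    using n_ary_hom_f_star(1)[OF sub len] xy rt d by (simp add: extend_def pq)
qed

lemma extend_restrict: "x \<in> G \<Longrightarrow> extend \<Lambda> (x, 0) = \<Lambda> x"
  by (simp add: extend_def n_ary_hom_closed)

end

lemma restrict_extend:
  assumes "\<Gamma> \<in> hom C H" "\<Gamma> \<in> extensional (carrier C)"
  shows "extend (\<lambda>x\<in>G. \<Gamma> (x, 0)) = \<Gamma>"
proof (rule extensionalityI[of _ "carrier C"])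
  show "extend (\<lambda>x\<in>G. \<Gamma> (x, 0)) \<in> extensional (carrier C)"
    by (simp add: extend_def carrier_C)
qed (use assms base hom_covering_decompose[OF assms(1), symmetric] in \<open>auto simp: extend_def carrier_C\<close>)

lemma n_ary_hom_cong:
  assumes "n_ary_hom \<Lambda>" "\<And>x. x \<in> G \<Longrightarrow> \<Lambda> x = \<Lambda>' x"
  shows "n_ary_hom \<Lambda>'"
  unfolding n_ary_hom_def
proof (intro conjI ballI impI)
  fix xs assume xs: "xs \<in> lists G" "length xs = n"
  have "\<Lambda>' (f xs) = \<Lambda> (f xs)"
    using assms(2) closed[OF xs] by simp
  also have "\<dots> = list_prod (map \<Lambda> xs)"
    using assms(1) xs by (simp add: n_ary_hom_def)
  also have "map \<Lambda> xs = map \<Lambda>' xs"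
    by (rule map_cong) (use assms(2) xs(1) in blast)+
  finally show "\<Lambda>' (f xs) = list_prod (map \<Lambda>' xs)" .
next
  show "\<Lambda>' \<in> G \<rightarrow> carrier H"
    using assms by (metis n_ary_hom_def Pi_cong)
qed

end

section \<open>The general linear group\<close>

lemma GL_simps:
  shows one_GL: "\<one>\<^bsub>GL scale V\<^esub> = (\<lambda>v\<in>V. v)"
    and mult_GL: "S \<in> carrier (GL scale V) \<Longrightarrow> T \<in> carrier (GL scale V) \<Longrightarrow>
      S \<otimes>\<^bsub>GL scale V\<^esub> T = compose V S T"
  by (auto simp: GL_def BijGroup_def)

lemma GL_group:
  assumes "vector_space scale" "module.subspace scale V"
  shows "group (GL scale V)"
proof -
  interpret vector_space scale by fact
  have add: "u + v \<in> V" if "u \<in> V" "v \<in> V" for u v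
    using assms(2) that by (rule subspace_add)
  have sc: "scale c v \<in> V" if "v \<in> V" for c v
    using assms(2) that by (rule subspace_scale)
  interpret B: group "BijGroup V" by (rule group_BijGroup)
  have "subgroup (carrier (GL scale V)) (BijGroup V)"
  proof (rule B.subgroupI)
    show "carrier (GL scale V) \<subseteq> carrier (BijGroup V)"
      by (auto simp: GL_def BijGroup_def)
    have "(\<lambda>v\<in>V. v) \<in> carrier (GL scale V)"
      using add sc id_Bij[of V] by (simp add: GL_def)
    then show "carrier (GL scale V) \<noteq> {}"
      by blast
  next
    fix T assume T: "T \<in> carrier (GL scale V)"
    then have bij: "T \<in> Bij V" "bij_betw T V V"
      and lin: "\<And>u v. u \<in> V \<Longrightarrow> v \<in> V \<Longrightarrow> T (u + v) = T u + T v"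
        "\<And>c v. v \<in> V \<Longrightarrow> T (scale c v) = scale c (T v)"
      by (auto simp: GL_def Bij_def)
    let ?I = "inv_into V T"
    have I: "?I v \<in> V" "T (?I v) = v" if "v \<in> V" for v
      using bij that by (auto simp: bij_betw_def inv_into_into f_inv_into_f)
    have inj: "u = v" if "T u = T v" "u \<in> V" "v \<in> V" for u v
      using bij that by (auto simp: bij_betw_def inj_on_def)
    have "?I (u + v) = ?I u + ?I v" if "u \<in> V" "v \<in> V" for u v
      using that by - (rule inj, auto simp: I lin add)
    moreover have "?I (scale c v) = scale c (?I v)" if "v \<in> V" for c v
      using that by - (rule inj, auto simp: I lin sc)
    moreover have "inv\<^bsub>BijGroup V\<^esub> T = (\<lambda>v\<in>V. ?I v)"
      by (rule inv_BijGroup) fact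
    ultimately show "inv\<^bsub>BijGroup V\<^esub> T \<in> carrier (GL scale V)"
      using restrict_inv_into_Bij[OF bij(1)] add sc by (simp add: GL_def)
  next
    fix S T assume ST: "S \<in> carrier (GL scale V)" "T \<in> carrier (GL scale V)"
    then have "S \<in> Bij V" "T \<in> Bij V" and "\<And>v. v \<in> V \<Longrightarrow> T v \<in> V"
      by (auto simp: GL_def Bij_def bij_betw_def)
    then show "S \<otimes>\<^bsub>BijGroup V\<^esub> T \<in> carrier (GL scale V)"
      using ST add sc compose_Bij[of S V T] by (auto simp: GL_def BijGroup_def compose_eq)
  qed
  then have "group ((BijGroup V)\<lparr>carrier := carrier (GL scale V)\<rparr>)"
    by (rule B.subgroup_imp_group)
  then show ?thesis
    by (simp add: GL_def)
qed

lemma GL_mult_invariant: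
  assumes "S \<in> carrier (GL scale V)" "T \<in> carrier (GL scale V)"
    and "W \<subseteq> V" "S ` W \<subseteq> W" "T ` W \<subseteq> W"
  shows "(S \<otimes>\<^bsub>GL scale V\<^esub> T) ` W \<subseteq> W"
proof -
  have "(S \<otimes>\<^bsub>GL scale V\<^esub> T) w = S (T w)" if "w \<in> W" for w
    using assms(1-3) that by (auto simp: mult_GL compose_eq)
  then have "(S \<otimes>\<^bsub>GL scale V\<^esub> T) ` W = S ` T ` W"
    by (simp add: image_image)
  also have "\<dots> \<subseteq> W"
    using assms(4,5) by (meson image_mono order_trans)
  finally show ?thesis .
qed

lemma GL_pow_invariant:
  assumes "group (GL scale V)" "T \<in> carrier (GL scale V)" "W \<subseteq> V" "T ` W \<subseteq> W"
  shows "(T [^]\<^bsub>GL scale V\<^esub> (k::nat)) ` W \<subseteq> W"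
proof (induction k)
  case 0
  then show ?case
    using assms(3) by (auto simp: one_GL)
next
  case (Suc k)
  interpret group "GL scale V" by fact
  show ?case
    unfolding nat_pow_Suc
    by (rule GL_mult_invariant[OF nat_pow_closed[OF assms(2)] assms(2,3) Suc assms(4)])
qed

section \<open>The correspondence of irreducible representations\<close>

lemma irreducible_on_iff_same_invariants:
  assumes "\<And>W. W \<subseteq> V \<Longrightarrow> (\<forall>T\<in>A. T ` W \<subseteq> W) \<longleftrightarrow> (\<forall>T\<in>B. T ` W \<subseteq> W)"
  shows "irreducible_on scale V A \<longleftrightarrow> irreducible_on scale V B"
proof -
  have "(module.subspace scale W \<and> W \<subseteq> V \<and> (\<forall>T\<in>A. T ` W \<subseteq> W)) \<longleftrightarrow>
      (module.subspace scale W \<and> W \<subseteq> V \<and> (\<forall>T\<in>B. T ` W \<subseteq> W))" for W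
    using assms[of W] by argo
  then show ?thesis
    by (simp only: irreducible_on_def)
qed

text \<open>By \<open>hom_covering_decompose\<close> the operators of the covering group are products of operators
  that belong to elements of \<open>G\<close>.\<close>

lemma irreducible_on_covering:
  assumes "covering n G f (GL scale V) a" and \<Gamma>: "\<Gamma> \<in> hom (covering_group n G f a) (GL scale V)"
  shows "irreducible_on scale V ((\<lambda>x. \<Gamma> (x, 0)) ` G) \<longleftrightarrow>
    irreducible_on scale V (\<Gamma> ` carrier (covering_group n G f a))"
proof (rule irreducible_on_iff_same_invariants)
  fix W assume W: "W \<subseteq> V"
  interpret covering n G f "GL scale V" a by fact
  have cl: "\<Gamma> (x, 0) \<in> carrier (GL scale V)" if "x \<in> G" for x
    using \<Gamma> that by (auto simp: hom_def carrier_C)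
  have "\<Gamma> p ` W \<subseteq> W" if inv: "\<forall>T \<in> (\<lambda>x. \<Gamma> (x, 0)) ` G. T ` W \<subseteq> W" and "p \<in> carrier C" for p
  proof -
    obtain x r where p: "p = (x, r)" "x \<in> G" "r \<le> n - 2"
      using \<open>p \<in> carrier C\<close> by (auto simp: carrier_C)
    have "(\<Gamma> (x, 0) \<otimes>\<^bsub>GL scale V\<^esub> \<Gamma> (a, 0) [^]\<^bsub>GL scale V\<^esub> r) ` W \<subseteq> W"
      using p base
      by (intro GL_mult_invariant[OF cl H.nat_pow_closed[OF cl] W bspec[OF inv]
            GL_pow_invariant[OF H.group_axioms cl W bspec[OF inv]]] imageI)
    then show ?thesis
      using hom_covering_decompose[OF \<Gamma> p(2,3)] p by simp
  qed
  moreover have "(\<lambda>x. \<Gamma> (x, 0)) ` G \<subseteq> \<Gamma> ` carrier C"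
    by (auto simp: carrier_C)
  ultimately show "(\<forall>T \<in> (\<lambda>x. \<Gamma> (x, 0)) ` G. T ` W \<subseteq> W) \<longleftrightarrow> (\<forall>T \<in> \<Gamma> ` carrier C. T ` W \<subseteq> W)"
    by (metis (mono_tags, lifting) imageE subsetD)
qed

theorem theorem4p3:
  fixes n :: nat and G :: "'a set" and f :: "'a list \<Rightarrow> 'a" and a :: 'a
    and scale :: "complex \<Rightarrow> 'v::ab_group_add \<Rightarrow> 'v"
  assumes "n > 2"
    and "n_ary_group n G f"
    and "a \<in> G"
    and "vector_space scale"
  shows "\<exists>\<phi>. bij_betw \<phi>
    (n_ary_irreps n G f scale)
    {(V, \<Lambda>) \<in> group_irreps (covering_group n G f a) scale.
       kernel (covering_group n G f a) (GL scale V) \<Lambda> \<inter> (\<lambda>x. (x, 0)) ` G \<noteq> {}}"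
proof -
  let ?C = "covering_group n G f a"
  let ?ext = "\<lambda>(V, \<Lambda>). (V, covering.extend n G (GL scale V) a \<Lambda>)"
  let ?res = "\<lambda>(V, \<Gamma>). (V, \<lambda>x\<in>G. \<Gamma> (x, 0::nat))"
  let ?A = "n_ary_irreps n G f scale"
  let ?B = "{(V, \<Lambda>) \<in> group_irreps ?C scale.
    kernel ?C (GL scale V) \<Lambda> \<inter> (\<lambda>x. (x, 0)) ` G \<noteq> {}}"
  have cov: "covering n G f (GL scale V) a" if "fin_dim_subspace scale V" for V
    using assms that GL_group[OF assms(4), of V]
    by (auto simp: covering_def covering_axioms_def fin_dim_subspace_def)
  have A: "?ext (V, \<Lambda>) \<in> ?B \<and> ?res (?ext (V, \<Lambda>)) = (V, \<Lambda>)" if mem: "(V, \<Lambda>) \<in> ?A" for V \<Lambda>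
  proof -
    have fd: "fin_dim_subspace scale V" and rep: "n_ary_rep n G f scale V \<Lambda>"
      and irr: "irreducible_on scale V (\<Lambda> ` G)"
      using mem by (auto simp: n_ary_irreps_def)
    interpret covering n G f "GL scale V" a
      using fd by (rule cov)
    have \<Lambda>: "n_ary_hom \<Lambda>"
      using rep by (auto simp: n_ary_rep_def n_ary_hom_def)
    note hom = extend_hom[OF \<Lambda>] and ext = extend_restrict[OF \<Lambda>]
    have "extend \<Lambda> \<in> extensional (carrier C)"
      by (simp add: extend_def carrier_C)
    moreover have "(\<lambda>x. extend \<Lambda> (x, 0)) ` G = \<Lambda> ` G"
      using ext by auto
    then have "irreducible_on scale V (extend \<Lambda> ` carrier C)"
      using irreducible_on_covering[OF cov[OF fd] hom] irr by simp
    moreover obtain x where "x \<in> G" "\<Lambda> x = \<one>\<^bsub>GL scale V\<^esub>"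
      using rep by (auto simp: n_ary_rep_def)
    then have "(x, 0) \<in> kernel C (GL scale V) (extend \<Lambda>) \<inter> (\<lambda>x. (x, 0)) ` G"
      by (auto simp: kernel_def carrier_C ext)
    moreover have "(\<lambda>x\<in>G. extend \<Lambda> (x, 0)) = \<Lambda>"
      using rep ext by (intro extensionalityI[of _ G]) (auto simp: n_ary_rep_def PiE_def)
    ultimately show ?thesis
      using fd hom by (auto simp: group_irreps_def group_rep_def)
  qed
  have B: "?res (V, \<Gamma>) \<in> ?A \<and> ?ext (?res (V, \<Gamma>)) = (V, \<Gamma>)" if mem: "(V, \<Gamma>) \<in> ?B" for V \<Gamma>
  proof -
    have fd: "fin_dim_subspace scale V" and \<Gamma>: "\<Gamma> \<in> hom ?C (GL scale V)" "\<Gamma> \<in> extensional (carrier ?C)"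
      and irr: "irreducible_on scale V (\<Gamma> ` carrier ?C)"
      and ker: "kernel ?C (GL scale V) \<Gamma> \<inter> (\<lambda>x. (x, 0)) ` G \<noteq> {}"
      using mem by (auto simp: group_irreps_def group_rep_def)
    interpret covering n G f "GL scale V" a
      using fd by (rule cov)
    let ?L = "\<lambda>x\<in>G. \<Gamma> (x, 0)"
    have "n_ary_hom ?L"
      by (rule n_ary_hom_cong[OF n_ary_hom_restrict[OF \<Gamma>(1)]]) simp
    moreover have "{x \<in> G. ?L x = \<one>\<^bsub>GL scale V\<^esub>} \<noteq> {}"
      using ker by (auto simp: kernel_def)
    ultimately have "n_ary_rep n G f scale V ?L"
      by (simp add: n_ary_rep_def n_ary_hom_def PiE_def)
    moreover have "irreducible_on scale V (?L ` G)"
      using irreducible_on_covering[OF cov[OF fd] \<Gamma>(1)] irr by simp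
    ultimately show ?thesis
      using fd restrict_extend[OF \<Gamma>] by (simp add: n_ary_irreps_def)
  qed
  have "bij_betw ?ext ?A ?B"
    by (rule bij_betw_byWitness[where f' = ?res]) (use A B in fast)+
  then show ?thesis
    by blast
qed

end
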